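(* Let $R$ be a commutative ring with identity, $S$ a multiplicative subset of $R$, $M$ an $R$-module, and $s\in S$. Then the following statements are equivalent: (1) $M$ is a $u$-$S$-Artinian module with respect to $s$; (2) $M$ satisfies the ($S$-MIN)-condition with respect to $s$; (3) for any nonempty family $\{N_i\}_{i\in\Gamma}$ of submodules of $M$, there is a finite subset $\Gamma_0\subseteq\Gamma$ such that $s\bigcap_{i\in\Gamma_0}N_i\subseteq\bigcap_{i\in\Gamma}N_i$; (4) every factor module $M/N$ (with $N$ a submodule of $M$) is $u$-$S$-cofinite with respect to $s$.
   Context: All rings are commutative with identity and all modules are unitary. A subset $S$ of $R$ is multiplicative if $1\in S$ and $s_1s_2\in S$ for all $s_1,s_2\in S$. $M$ is $u$-$S$-Artinian with respect to $s\in S$ if for every descending chain $M_1\supseteq M_2\supseteq\cdots$ of submodules of $M$ there is $k\in\mathbb{Z}^{+}$ (depending on the chain) such that $sM_k\subseteq M_n$ for all $n\geq k$. Given a nonempty family $\mathcal{N}$ of submodules of $M$, an element $N\in\mathcal{N}$ is an $S$-minimal element of $\mathcal{N}$ with respect to $s$ if whenever $N'\in\mathcal{N}$ and $N'\subseteq N$, then $sN\subseteq N'$. $M$ satisfies the ($S$-MIN)-condition with respect to $s$ if every nonempty family of submodules of $M$ has an $S$-minimal element with respect to $s$. An $R$-module $L$ is $u$-$S$-cofinite with respect to $s$ if for each nonempty family $\{L_i\}_{i\in\Delta}$ of submodules of $L$, $\bigcap_{i\in\Delta}L_i=0$ implies that $s\bigl(\bigcap_{i\in\Delta'}L_i\bigr)=0$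 for some finite subset $\Delta'\subseteq\Delta$. *)

theory Defs
  imports "HOL-Algebra.Module" "HOL-Algebra.AbelCoset"
begin

text \<open>
  The \<^term>\<open>mult\<close> and \<^term>\<open>one\<close> fields of a module record carry no meaning and are left
  unspecified. As for factor rings, scalar multiplication is given by the union over all
  representatives of a coset, which is the single coset \<open>N +> a \<odot> x\<close>.
\<close>

definition factor_module :: "('a, 'b, 'm) module_scheme \<Rightarrow> 'b set \<Rightarrow> ('a, 'b set) module"
  where "factor_module M N =
    \<lparr>carrier = a_rcosets\<^bsub>M\<^esub> N, mult = undefined, one = undefined, zero = N, add = set_add M,
     smult = (\<lambda>a X. \<Union>x\<in>X. N +>\<^bsub>M\<^esub> (a \<odot>\<^bsub>M\<^esub> x))\<rparr>"

text \<open>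
  In the following notions the multiplicative set \<open>S\<close> enters only through its element \<open>s\<close>,
  and the submodule \<open>sN\<close> is the image of \<open>N\<close> under multiplication by \<open>s\<close>.
  Chains are indexed from 0.
\<close>

definition u_S_Artinian ::
    "('a, 'r) ring_scheme \<Rightarrow> ('a, 'b, 'm) module_scheme \<Rightarrow> 'a \<Rightarrow> bool"
  where "u_S_Artinian R M s \<longleftrightarrow>
    (\<forall>C :: nat \<Rightarrow> 'b set. (\<forall>n. submodule (C n) R M) \<and> (\<forall>n. C (Suc n) \<subseteq> C n) \<longrightarrow>
      (\<exists>k. \<forall>n\<ge>k. (\<lambda>x. s \<odot>\<^bsub>M\<^esub> x) ` C k \<subseteq> C n))"

definition S_minimal ::
    "('a, 'b, 'm) module_scheme \<Rightarrow> 'a \<Rightarrow> 'b set set \<Rightarrow> 'b set \<Rightarrow> bool"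
  where "S_minimal M s F N \<longleftrightarrow>
    N \<in> F \<and> (\<forall>N'\<in>F. N' \<subseteq> N \<longrightarrow> (\<lambda>x. s \<odot>\<^bsub>M\<^esub> x) ` N \<subseteq> N')"

definition S_MIN ::
    "('a, 'r) ring_scheme \<Rightarrow> ('a, 'b, 'm) module_scheme \<Rightarrow> 'a \<Rightarrow> bool"
  where "S_MIN R M s \<longleftrightarrow>
    (\<forall>F. F \<noteq> {} \<and> (\<forall>N\<in>F. submodule N R M) \<longrightarrow> (\<exists>N. S_minimal M s F N))"

text \<open>The intersection of a family of submodules of \<open>M\<close>; the empty intersection is \<open>M\<close>.\<close>

definition family_Inter :: "('a, 'b, 'm) module_scheme \<Rightarrow> 'i set \<Rightarrow> ('i \<Rightarrow> 'b set) \<Rightarrow> 'b set"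
  where "family_Inter M I N = carrier M \<inter> (\<Inter>i\<in>I. N i)"

text \<open>
  A definition cannot quantify over index types. The type \<^typ>\<open>'b set\<close> is large enough to
  index every set of submodules by itself; the lemmas \<open>finite_Inter_condition_any_index\<close> and
  \<open>u_S_cofinite_any_index\<close> below show that families over all other index types are covered.
\<close>

definition finite_Inter_condition ::
    "('a, 'r) ring_scheme \<Rightarrow> ('a, 'b, 'm) module_scheme \<Rightarrow> 'a \<Rightarrow> bool"
  where "finite_Inter_condition R M s \<longleftrightarrow>
    (\<forall>(I :: 'b set set) N. I \<noteq> {} \<and> (\<forall>i\<in>I. submodule (N i) R M) \<longrightarrow>
      (\<exists>J. finite J \<and> J \<subseteq> I \<and>
        (\<lambda>x. s \<odot>\<^bsub>M\<^esub> x) ` family_Inter M J N \<subseteq> family_Inter M I N))"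

definition u_S_cofinite ::
    "('a, 'r) ring_scheme \<Rightarrow> ('a, 'b, 'm) module_scheme \<Rightarrow> 'a \<Rightarrow> bool"
  where "u_S_cofinite R L s \<longleftrightarrow>
    (\<forall>(I :: 'b set set) N. I \<noteq> {} \<and> (\<forall>i\<in>I. submodule (N i) R L) \<longrightarrow>
      family_Inter L I N = {\<zero>\<^bsub>L\<^esub>} \<longrightarrow>
      (\<exists>J. finite J \<and> J \<subseteq> I \<and> (\<lambda>x. s \<odot>\<^bsub>L\<^esub> x) ` family_Inter L J N = {\<zero>\<^bsub>L\<^esub>}))"

lemma family_Inter_image: "family_Inter M (f ` J) (\<lambda>X. X) = family_Inter M J f"
  by (simp add: family_Inter_def)

lemma finite_Inter_condition_any_index:
  fixes I :: "'i set"
  assumes "finite_Inter_condition R M s" "I \<noteq> {}" "\<And>i. i \<in> I \<Longrightarrow> submodule (N i) R M"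
  shows "\<exists>J. finite J \<and> J \<subseteq> I \<and>
    (\<lambda>x. s \<odot>\<^bsub>M\<^esub> x) ` family_Inter M J N \<subseteq> family_Inter M I N"
proof -
  have "N ` I \<noteq> {} \<and> (\<forall>X\<in>N ` I. submodule X R M)"
    using assms(2,3) by auto
  then obtain K where K: "finite K" "K \<subseteq> N ` I"
    "(\<lambda>x. s \<odot>\<^bsub>M\<^esub> x) ` family_Inter M K (\<lambda>X. X) \<subseteq> family_Inter M (N ` I) (\<lambda>X. X)"
    using assms(1)[unfolded finite_Inter_condition_def, rule_format, of "N ` I" "\<lambda>X. X"] by blast
  obtain J where "finite J" "J \<subseteq> I" "K = N ` J"
    using K(1,2) by (meson finite_subset_image)
  then show ?thesis
    using K(3) by (auto simp: family_Inter_image)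
qed

lemma u_S_cofinite_any_index:
  fixes I :: "'i set"
  assumes "u_S_cofinite R L s" "I \<noteq> {}" "\<And>i. i \<in> I \<Longrightarrow> submodule (N i) R L"
    and "family_Inter L I N = {\<zero>\<^bsub>L\<^esub>}"
  shows "\<exists>J. finite J \<and> J \<subseteq> I \<and> (\<lambda>x. s \<odot>\<^bsub>L\<^esub> x) ` family_Inter L J N = {\<zero>\<^bsub>L\<^esub>}"
proof -
  have "N ` I \<noteq> {} \<and> (\<forall>X\<in>N ` I. submodule X R L)"
    using assms(2,3) by auto
  moreover have "family_Inter L (N ` I) (\<lambda>X. X) = {\<zero>\<^bsub>L\<^esub>}"
    using assms(4) by (simp add: family_Inter_image)
  ultimately obtain K where K: "finite K" "K \<subseteq> N ` I"
    "(\<lambda>x. s \<odot>\<^bsub>L\<^esub> x) ` family_Inter L K (\<lambda>X. X) = {\<zero>\<^bsub>L\<^esub>}"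
    using assms(1)[unfolded u_S_cofinite_def, rule_format, of "N ` I" "\<lambda>X. X"] by blast
  obtain J where "finite J" "J \<subseteq> I" "K = N ` J"
    using K(1,2) by (meson finite_subset_image)
  then show ?thesis
    using K(3) by (auto simp: family_Inter_image)
qed

context
  fixes R (structure) and M (structure) and N
  assumes M: "module R M" and N: "submodule N R M"
begin

interpretation module R M by (rule M)

interpretation abelian_subgroup N M
  by (rule abelian_subgroupI3)
    (use submodule.axioms(1)[OF N] in \<open>auto intro: additive_subgroup.intro M.abelian_group_axioms\<close>)

lemma factor_module_smult:
  assumes a: "a \<in> carrier R" and x: "x \<in> carrier M"
  shows "a \<odot>\<^bsub>factor_module M N\<^esub> (N +>\<^bsub>M\<^esub> x) = N +>\<^bsub>M\<^esub> (a \<odot>\<^bsub>M\<^esub> x)"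
proof -
  have eq: "N +>\<^bsub>M\<^esub> (a \<odot>\<^bsub>M\<^esub> y) = N +>\<^bsub>M\<^esub> (a \<odot>\<^bsub>M\<^esub> x)" if y: "y \<in> N +>\<^bsub>M\<^esub> x" for y
  proof -
    obtain h where h: "h \<in> N" "y = h \<oplus>\<^bsub>M\<^esub> x"
      using y by (auto simp: a_r_coset_def')
    have "a \<odot>\<^bsub>M\<^esub> y = a \<odot>\<^bsub>M\<^esub> h \<oplus>\<^bsub>M\<^esub> a \<odot>\<^bsub>M\<^esub> x"
      using h a x by (simp add: smult_r_distr a_Hcarr)
    moreover have "a \<odot>\<^bsub>M\<^esub> h \<in> N"
      using submodule.smult_closed[OF N a h(1)] .
    ultimately have "a \<odot>\<^bsub>M\<^esub> y \<in> N +>\<^bsub>M\<^esub> (a \<odot>\<^bsub>M\<^esub> x)"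
      by (auto simp: a_r_coset_def')
    then show ?thesis
      using M.a_repr_independence'[OF _ smult_closed[OF a x] submodule.axioms(1)[OF N]] by (simp add: a_r_coset_def)
  qed
  have "x \<in> N +>\<^bsub>M\<^esub> x"
    using x by (rule a_rcos_self)
  then have "(\<Union>y\<in>N +>\<^bsub>M\<^esub> x. N +>\<^bsub>M\<^esub> (a \<odot>\<^bsub>M\<^esub> y)) = N +>\<^bsub>M\<^esub> (a \<odot>\<^bsub>M\<^esub> x)"
    using eq by blast
  then show ?thesis
    by (simp add: factor_module_def)
qed

lemma factor_module_is_module: "module R (factor_module M N)"
proof (rule moduleI)
  show "cring R" using M by (rule module.axioms(1))
  have car: "carrier (factor_module M N) = (\<lambda>x. N +>\<^bsub>M\<^esub> x) ` carrier M"
    by (auto simp: factor_module_def A_RCOSETS_def')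
  have add: "(N +>\<^bsub>M\<^esub> x) \<oplus>\<^bsub>factor_module M N\<^esub> (N +>\<^bsub>M\<^esub> y) = N +>\<^bsub>M\<^esub> (x \<oplus>\<^bsub>M\<^esub> y)"
    if "x \<in> carrier M" "y \<in> carrier M" for x y
    using that by (simp add: factor_module_def a_rcos_sum)
  have zero: "\<zero>\<^bsub>factor_module M N\<^esub> = N +>\<^bsub>M\<^esub> \<zero>\<^bsub>M\<^esub>"
    using M.add.coset_mult_one[OF a_subset] by (simp add: factor_module_def a_r_coset_def)
  show "abelian_group (factor_module M N)"
  proof (rule abelian_groupI)
    fix X assume "X \<in> carrier (factor_module M N)"
    then obtain x where x: "x \<in> carrier M" "X = N +>\<^bsub>M\<^esub> x"
      unfolding car by blast
    have "N +>\<^bsub>M\<^esub> (\<ominus>\<^bsub>M\<^esub> x) \<in> carrier (factor_module M N)"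
      unfolding car using x by blast
    moreover have "(N +>\<^bsub>M\<^esub> (\<ominus>\<^bsub>M\<^esub> x)) \<oplus>\<^bsub>factor_module M N\<^esub> X = \<zero>\<^bsub>factor_module M N\<^esub>"
      using x by (simp add: add zero M.l_neg)
    ultimately show "\<exists>Y\<in>carrier (factor_module M N).
        Y \<oplus>\<^bsub>factor_module M N\<^esub> X = \<zero>\<^bsub>factor_module M N\<^esub>"
      by blast
  qed (auto simp: car add zero M.a_ac)
  show "a \<odot>\<^bsub>factor_module M N\<^esub> X \<in> carrier (factor_module M N)" if "a \<in> carrier R" "X \<in> carrier (factor_module M N)" for a X
    using that by (auto simp: car factor_module_smult)
  show "\<one> \<odot>\<^bsub>factor_module M N\<^esub> X = X" if "X \<in> carrier (factor_module M N)" for X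
    using that by (auto simp: car factor_module_smult)
  show "a \<odot>\<^bsub>factor_module M N\<^esub> (X \<oplus>\<^bsub>factor_module M N\<^esub> Y) = a \<odot>\<^bsub>factor_module M N\<^esub> X \<oplus>\<^bsub>factor_module M N\<^esub> a \<odot>\<^bsub>factor_module M N\<^esub> Y"
    if "a \<in> carrier R" "X \<in> carrier (factor_module M N)" "Y \<in> carrier (factor_module M N)" for a X Y
    using that by (auto simp: car factor_module_smult add smult_r_distr)
  show "(a \<oplus> b) \<odot>\<^bsub>factor_module M N\<^esub> X = a \<odot>\<^bsub>factor_module M N\<^esub> X \<oplus>\<^bsub>factor_module M N\<^esub> b \<odot>\<^bsub>factor_module M N\<^esub> X"
    if "a \<in> carrier R" "b \<in> carrier R" "X \<in> carrier (factor_module M N)" for a b X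
    using that by (auto simp: car factor_module_smult add smult_l_distr)
  show "(a \<otimes> b) \<odot>\<^bsub>factor_module M N\<^esub> X = a \<odot>\<^bsub>factor_module M N\<^esub> (b \<odot>\<^bsub>factor_module M N\<^esub> X)"
    if "a \<in> carrier R" "b \<in> carrier R" "X \<in> carrier (factor_module M N)" for a b X
    using that by (auto simp: car factor_module_smult smult_assoc1)
qed

end

end

theory Submission
  imports Defs
begin

text \<open>
  The first three conditions are compared inside the lattice of submodules of \<open>M\<close>, in a cycle.
  If a family has no \<open>S\<close>-minimal element, then below each of its members \<open>N\<close> lies a member
  not containing \<open>sN\<close>, and iterating this choice produces a descending chain in which no term,
  multiplied by \<open>s\<close>, falls into the next one. Conversely the finite intersections of a
  given family form a family of submodules, and if \<open>K\<close> is \<open>S\<close>-minimal among them, then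
  comparing \<open>K\<close> with \<open>K \<inter> N\<^sub>i\<close> gives \<open>sK \<subseteq> N\<^sub>i\<close> for all \<open>i\<close>, which is the condition on finite
  intersections. That condition in turn bounds a descending chain, since a finite intersection of
  its terms contains one of them. Throughout, \<open>s\<close> is applied only once, so the same \<open>s\<close> serves
  for all conditions and no powers of \<open>s\<close> appear.

  The fourth condition is the third one seen through the quotient maps \<open>M \<rightarrow> M/N\<close>. Taking images
  and preimages matches the submodules of \<open>M/N\<close> with the submodules of \<open>M\<close> that contain \<open>N\<close>, and
  is compatible with intersections. Under it, a family with zero intersection in \<open>M/N\<close> is a
  family with intersection \<open>N\<close> in \<open>M\<close>, and \<open>s\<close> kills a submodule of \<open>M/N\<close> exactly when it
  sends its preimage into \<open>N\<close>. Cofiniteness of \<open>M/N\<close> is thus the third condition for the families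
  with intersection \<open>N\<close>, and every family has some submodule as its intersection.
\<close>

section \<open>Submodules and their intersections\<close>

context module
begin

text \<open>Closure under negation comes for free, because \<open>-x = (-1) x\<close>.\<close>

lemma submodule_iff_closed:
  "submodule H R M \<longleftrightarrow> H \<subseteq> carrier M \<and> \<zero>\<^bsub>M\<^esub> \<in> H \<and>
    (\<forall>x\<in>H. \<forall>y\<in>H. x \<oplus>\<^bsub>M\<^esub> y \<in> H) \<and> (\<forall>a\<in>carrier R. \<forall>x\<in>H. a \<odot>\<^bsub>M\<^esub> x \<in> H)"
  (is "_ \<longleftrightarrow> ?closed")
proof
  assume H: "submodule H R M"
  then have "\<zero>\<^bsub>M\<^esub> \<in> H"
    using subgroup.one_closed[OF submodule.axioms(1)[OF H]] by simp
  then show ?closed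
    using submoduleE[OF H] by blast
next
  assume H: ?closed
  show "submodule H R M"
  proof (rule submoduleI)
    fix x assume x: "x \<in> H"
    have "(\<ominus> \<one>) \<odot>\<^bsub>M\<^esub> x = \<ominus>\<^bsub>M\<^esub> x"
      using smult_l_minus[of \<one> x] x H by auto
    then show "\<ominus>\<^bsub>M\<^esub> x \<in> H"
      using H x by (metis R.add.inv_closed R.one_closed)
  qed (use H in auto)
qed

lemma submodule_family_Inter:
  assumes "\<And>i. i \<in> I \<Longrightarrow> submodule (N i) R M"
  shows "submodule (family_Inter M I N) R M"
  using assms unfolding submodule_iff_closed family_Inter_def by auto

end

section \<open>Chains, minimal elements and finite intersections\<close>

lemma u_S_Artinian_imp_S_MIN:
  fixes M :: "('a, 'b, 'm) module_scheme"
  assumes art: "u_S_Artinian R M s"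
  shows "S_MIN R M s"
  unfolding S_MIN_def
proof (intro allI impI, rule ccontr)
  fix F :: "'b set set"
  assume F: "F \<noteq> {} \<and> (\<forall>N\<in>F. submodule N R M)" and none: "\<not> (\<exists>N. S_minimal M s F N)"
  let ?below = "\<lambda>N N'. N' \<subseteq> N \<and> \<not> (\<lambda>x. s \<odot>\<^bsub>M\<^esub> x) ` N \<subseteq> N'"
  have step: "\<exists>N'. N' \<in> F \<and> ?below N N'" if "N \<in> F" for N
    using none that unfolding S_minimal_def by metis
  obtain N\<^sub>0 where "N\<^sub>0 \<in> F"
    using F by blast
  then have "\<exists>C. \<forall>n. C n \<in> F \<and> ?below (C n) (C (Suc n))"
    using dependent_nat_choice[of "\<lambda>_ N. N \<in> F" "\<lambda>_. ?below", OF exI step] by simp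
  then obtain C where C: "\<And>n. C n \<in> F" "\<And>n. ?below (C n) (C (Suc n))"
    by blast
  then have "(\<forall>n. submodule (C n) R M) \<and> (\<forall>n. C (Suc n) \<subseteq> C n)"
    using F by blast
  then obtain k where "\<forall>n\<ge>k. (\<lambda>x. s \<odot>\<^bsub>M\<^esub> x) ` C k \<subseteq> C n"
    using art unfolding u_S_Artinian_def by blast
  then have "(\<lambda>x. s \<odot>\<^bsub>M\<^esub> x) ` C k \<subseteq> C (Suc k)"
    using le_SucI by blast
  then show False
    using C(2) by blast
qed

lemma S_MIN_imp_finite_Inter_condition:
  fixes M :: "('a, 'b, 'm) module_scheme"
  assumes M: "module R M" and s: "s \<in> carrier R" and min: "S_MIN R M s"
  shows "finite_Inter_condition R M s"
  unfolding finite_Inter_condition_def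
proof (intro allI impI)
  interpret module R M by (rule M)
  fix I :: "'b set set" and N
  assume IN: "I \<noteq> {} \<and> (\<forall>i\<in>I. submodule (N i) R M)"
  define F where "F = {family_Inter M J N | J. finite J \<and> J \<subseteq> I}"
  have "submodule (family_Inter M J N) R M" if "J \<subseteq> I" for J
    by (rule submodule_family_Inter) (use IN that in blast)
  moreover have "F \<noteq> {}"
    unfolding F_def by blast
  ultimately have "F \<noteq> {} \<and> (\<forall>K\<in>F. submodule K R M)"
    unfolding F_def by blast
  then obtain K where K: "S_minimal M s F K"
    using min unfolding S_MIN_def by blast
  then obtain J where J: "finite J" "J \<subseteq> I" "K = family_Inter M J N"
    unfolding S_minimal_def F_def by blast
  have "(\<lambda>x. s \<odot>\<^bsub>M\<^esub> x) ` K \<subseteq> N i" if i: "i \<in> I" for i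
  proof -
    have "family_Inter M (insert i J) N \<in> F"
      unfolding F_def using i J by blast
    moreover have "family_Inter M (insert i J) N \<subseteq> K"
      unfolding J(3) family_Inter_def by blast
    ultimately have "(\<lambda>x. s \<odot>\<^bsub>M\<^esub> x) ` K \<subseteq> family_Inter M (insert i J) N"
      using K unfolding S_minimal_def by blast
    then show ?thesis
      by (auto simp: family_Inter_def)
  qed
  moreover have "(\<lambda>x. s \<odot>\<^bsub>M\<^esub> x) ` K \<subseteq> carrier M"
    using s unfolding J(3) family_Inter_def by auto
  ultimately have "(\<lambda>x. s \<odot>\<^bsub>M\<^esub> x) ` K \<subseteq> family_Inter M I N"
    unfolding family_Inter_def by blast
  then show "\<exists>J. finite J \<and> J \<subseteq> I \<and>
      (\<lambda>x. s \<odot>\<^bsub>M\<^esub> x) ` family_Inter M J N \<subseteq> family_Inter M I N"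
    using J by blast
qed

lemma finite_Inter_condition_imp_u_S_Artinian:
  fixes M :: "('a, 'b, 'm) module_scheme"
  assumes M: "module R M" and fin: "finite_Inter_condition R M s"
  shows "u_S_Artinian R M s"
  unfolding u_S_Artinian_def
proof (intro allI impI)
  interpret module R M by (rule M)
  fix C :: "nat \<Rightarrow> 'b set"
  assume C: "(\<forall>n. submodule (C n) R M) \<and> (\<forall>n. C (Suc n) \<subseteq> C n)"
  then have anti: "C n \<subseteq> C m" if "m \<le> n" for m n
    using lift_Suc_antimono_le[of C] that by blast
  obtain J where J: "finite J"
    "(\<lambda>x. s \<odot>\<^bsub>M\<^esub> x) ` family_Inter M J C \<subseteq> family_Inter M UNIV C"
    using finite_Inter_condition_any_index[OF fin, of UNIV C] C by auto
  obtain k where k: "\<forall>j\<in>J. j \<le> k"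
    using J(1) finite_nat_set_iff_bounded_le by blast
  have "C k \<subseteq> family_Inter M J C"
    using anti k C submoduleE(1) unfolding family_Inter_def by blast
  then have "(\<lambda>x. s \<odot>\<^bsub>M\<^esub> x) ` C k \<subseteq> C n" for n
    using J(2) unfolding family_Inter_def by blast
  then show "\<exists>k. \<forall>n\<ge>k. (\<lambda>x. s \<odot>\<^bsub>M\<^esub> x) ` C k \<subseteq> C n"
    by blast
qed

section \<open>Passage to factor modules\<close>

context module
begin

context
  fixes N assumes N: "submodule N R M"
begin

interpretation abelian_subgroup N M
  by (rule abelian_subgroupI3)
    (use submodule.axioms(1)[OF N] in \<open>auto intro: additive_subgroup.intro M.abelian_group_axioms\<close>)

interpretation quotient: module R "factor_module M N"
  by (rule factor_module_is_module[OF module_axioms N])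

lemma factor_module_carrier:
  "carrier (factor_module M N) = (\<lambda>x. N +>\<^bsub>M\<^esub> x) ` carrier M"
  by (auto simp: factor_module_def A_RCOSETS_def')

lemma factor_module_add:
  assumes "x \<in> carrier M" "y \<in> carrier M"
  shows "(N +>\<^bsub>M\<^esub> x) \<oplus>\<^bsub>factor_module M N\<^esub> (N +>\<^bsub>M\<^esub> y) = N +>\<^bsub>M\<^esub> (x \<oplus>\<^bsub>M\<^esub> y)"
  using assms by (simp add: factor_module_def a_rcos_sum)

lemma factor_module_zero: "\<zero>\<^bsub>factor_module M N\<^esub> = N"
  by (simp add: factor_module_def)

lemma coset_eq_zero_iff:
  assumes "x \<in> carrier M"
  shows "N +>\<^bsub>M\<^esub> x = \<zero>\<^bsub>factor_module M N\<^esub> \<longleftrightarrow> x \<in> N"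
  using assms a_rcos_self[of x] a_rcos_const[of x] by (auto simp: factor_module_zero)

lemma coset_in_image_iff:
  assumes K: "submodule K R M" and NK: "N \<subseteq> K" and x: "x \<in> carrier M"
  shows "N +>\<^bsub>M\<^esub> x \<in> (\<lambda>x. N +>\<^bsub>M\<^esub> x) ` K \<longleftrightarrow> x \<in> K"
proof
  assume "N +>\<^bsub>M\<^esub> x \<in> (\<lambda>x. N +>\<^bsub>M\<^esub> x) ` K"
  then obtain y where y: "y \<in> K" "x \<in> N +>\<^bsub>M\<^esub> y"
    using a_rcos_self[OF x] by auto
  then obtain h where "h \<in> N" "x = h \<oplus>\<^bsub>M\<^esub> y"
    by (auto simp: a_r_coset_def')
  then show "x \<in> K"
    using y(1) NK submoduleE(5)[OF K] by blast
qed simp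

lemma submodule_image_in_factor_module:
  assumes "submodule K R M"
  shows "submodule ((\<lambda>x. N +>\<^bsub>M\<^esub> x) ` K) R (factor_module M N)"
proof -
  have K: "K \<subseteq> carrier M" "\<zero>\<^bsub>M\<^esub> \<in> K" "\<And>x y. x \<in> K \<Longrightarrow> y \<in> K \<Longrightarrow> x \<oplus>\<^bsub>M\<^esub> y \<in> K"
    "\<And>a x. a \<in> carrier R \<Longrightarrow> x \<in> K \<Longrightarrow> a \<odot>\<^bsub>M\<^esub> x \<in> K"
    using assms unfolding submodule_iff_closed by auto
  have "\<zero>\<^bsub>factor_module M N\<^esub> \<in> (\<lambda>x. N +>\<^bsub>M\<^esub> x) ` K"
    using coset_eq_zero_iff[of "\<zero>\<^bsub>M\<^esub>"] K(2) submodule_iff_closed N by (metis M.zero_closed imageI)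
  moreover have "(N +>\<^bsub>M\<^esub> x) \<oplus>\<^bsub>factor_module M N\<^esub> (N +>\<^bsub>M\<^esub> y) \<in> (\<lambda>x. N +>\<^bsub>M\<^esub> x) ` K"
    if "x \<in> K" "y \<in> K" for x y
    using that K(1,3) factor_module_add[of x y] by (metis imageI subsetD)
  moreover have "a \<odot>\<^bsub>factor_module M N\<^esub> (N +>\<^bsub>M\<^esub> x) \<in> (\<lambda>x. N +>\<^bsub>M\<^esub> x) ` K"
    if "a \<in> carrier R" "x \<in> K" for a x
    using that K(1,4) factor_module_smult[OF module_axioms N, of a x] by (metis imageI subsetD)
  ultimately show ?thesis
    using K(1) unfolding quotient.submodule_iff_closed factor_module_carrier by blast
qed

lemma submodule_preimage_of_factor_module:
  assumes "submodule L R (factor_module M N)"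
  shows "submodule {x \<in> carrier M. N +>\<^bsub>M\<^esub> x \<in> L} R M"
proof -
  have L: "\<zero>\<^bsub>factor_module M N\<^esub> \<in> L"
    "\<And>X Y. X \<in> L \<Longrightarrow> Y \<in> L \<Longrightarrow> X \<oplus>\<^bsub>factor_module M N\<^esub> Y \<in> L"
    "\<And>a X. a \<in> carrier R \<Longrightarrow> X \<in> L \<Longrightarrow> a \<odot>\<^bsub>factor_module M N\<^esub> X \<in> L"
    using assms unfolding quotient.submodule_iff_closed by auto
  have "N +>\<^bsub>M\<^esub> \<zero>\<^bsub>M\<^esub> \<in> L"
    using coset_eq_zero_iff[of "\<zero>\<^bsub>M\<^esub>"] L(1) submodule_iff_closed N by (metis M.zero_closed)
  moreover have "N +>\<^bsub>M\<^esub> (x \<oplus>\<^bsub>M\<^esub> y) \<in> L"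
    if "x \<in> carrier M" "N +>\<^bsub>M\<^esub> x \<in> L" "y \<in> carrier M" "N +>\<^bsub>M\<^esub> y \<in> L" for x y
    using that L(2) factor_module_add[of x y] by metis
  moreover have "N +>\<^bsub>M\<^esub> (a \<odot>\<^bsub>M\<^esub> x) \<in> L"
    if "a \<in> carrier R" "x \<in> carrier M" "N +>\<^bsub>M\<^esub> x \<in> L" for a x
    using that L(3) factor_module_smult[OF module_axioms N, of a x] by metis
  ultimately show ?thesis
    unfolding submodule_iff_closed by auto
qed

lemma smult_factor_module_eq_zero_iff:
  assumes "a \<in> carrier R" "x \<in> carrier M"
  shows "a \<odot>\<^bsub>factor_module M N\<^esub> (N +>\<^bsub>M\<^esub> x) = \<zero>\<^bsub>factor_module M N\<^esub> \<longleftrightarrow> a \<odot>\<^bsub>M\<^esub> x \<in> N"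
  using assms factor_module_smult[OF module_axioms N, of a x] coset_eq_zero_iff by simp

text \<open>
  Preimages commute with every intersection, so the preimages of a family with zero intersection
  in \<open>M/N\<close> intersect in \<open>N\<close>, and \<open>s\<close> sends a finite intersection of them into \<open>N\<close>.
\<close>

lemma finite_Inter_condition_imp_factor_module_cofinite:
  assumes s: "s \<in> carrier R" and fin: "finite_Inter_condition R M s"
  shows "u_S_cofinite R (factor_module M N) s"
  unfolding u_S_cofinite_def
proof (intro allI impI)
  fix I :: "'c set set set" and L
  assume IL: "I \<noteq> {} \<and> (\<forall>i\<in>I. submodule (L i) R (factor_module M N))"
    and Inter_L: "family_Inter (factor_module M N) I L = {\<zero>\<^bsub>factor_module M N\<^esub>}"
  define P where "P i = {x \<in> carrier M. N +>\<^bsub>M\<^esub> x \<in> L i}" for i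
  have pull: "x \<in> family_Inter M J P \<longleftrightarrow> N +>\<^bsub>M\<^esub> x \<in> family_Inter (factor_module M N) J L"
    if "x \<in> carrier M" for x J
    using that by (auto simp: family_Inter_def P_def factor_module_carrier)
  have "submodule (P i) R M" if "i \<in> I" for i
    unfolding P_def using IL that submodule_preimage_of_factor_module by blast
  then obtain J where J: "finite J" "J \<subseteq> I"
    "(\<lambda>x. s \<odot>\<^bsub>M\<^esub> x) ` family_Inter M J P \<subseteq> family_Inter M I P"
    using finite_Inter_condition_any_index[OF fin, of I P] IL by blast
  have "s \<odot>\<^bsub>factor_module M N\<^esub> X = \<zero>\<^bsub>factor_module M N\<^esub>"
    if X: "X \<in> family_Inter (factor_module M N) J L" for X
  proof -
    obtain x where x: "x \<in> carrier M" "X = N +>\<^bsub>M\<^esub> x"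
      using X unfolding family_Inter_def factor_module_carrier by blast
    then have "s \<odot>\<^bsub>M\<^esub> x \<in> family_Inter M I P"
      using J(3) pull[of x J] X by blast
    then have "s \<odot>\<^bsub>M\<^esub> x \<in> N"
      using pull[of "s \<odot>\<^bsub>M\<^esub> x" I] Inter_L coset_eq_zero_iff[of "s \<odot>\<^bsub>M\<^esub> x"] s x(1) by simp
    then show ?thesis
      using smult_factor_module_eq_zero_iff s x by simp
  qed
  \<comment> \<open>The image under \<open>s\<close> has to equal the zero module, so it must not be empty.\<close>
  moreover have "\<zero>\<^bsub>factor_module M N\<^esub> \<in> family_Inter (factor_module M N) J L"
    using Inter_L J(2) by (auto simp: family_Inter_def)
  ultimately have "(\<lambda>X. s \<odot>\<^bsub>factor_module M N\<^esub> X) ` family_Inter (factor_module M N) J L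
      = {\<zero>\<^bsub>factor_module M N\<^esub>}"
    by (auto simp: image_iff)
  then show "\<exists>J. finite J \<and> J \<subseteq> I \<and> (\<lambda>X. s \<odot>\<^bsub>factor_module M N\<^esub> X) `
      family_Inter (factor_module M N) J L = {\<zero>\<^bsub>factor_module M N\<^esub>}"
    using J(1,2) by blast
qed

text \<open>
  All members of the family contain \<open>N\<close>, so each is recovered from its image in \<open>M/N\<close>;
  this is why taking images commutes with intersections here.
\<close>

lemma finite_Inter_if_factor_module_cofinite:
  assumes s: "s \<in> carrier R" and cof: "u_S_cofinite R (factor_module M N) s"
    and I: "I \<noteq> {}" and P: "\<And>i. i \<in> I \<Longrightarrow> submodule (P i) R M"
    and Inter_P: "family_Inter M I P = N"
  shows "\<exists>J. finite J \<and> J \<subseteq> I \<and> (\<lambda>x. s \<odot>\<^bsub>M\<^esub> x) ` family_Inter M J P \<subseteq> N"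
proof -
  define L where "L i = (\<lambda>x. N +>\<^bsub>M\<^esub> x) ` P i" for i
  have "N \<subseteq> P i" if "i \<in> I" for i
    using Inter_P that by (auto simp: family_Inter_def)
  then have push: "N +>\<^bsub>M\<^esub> x \<in> family_Inter (factor_module M N) J L \<longleftrightarrow> x \<in> family_Inter M J P"
    if "x \<in> carrier M" "J \<subseteq> I" for x J
    using that P coset_in_image_iff
    unfolding family_Inter_def L_def factor_module_carrier by (simp add: subset_iff)
  have "X \<in> family_Inter (factor_module M N) I L \<longleftrightarrow> X = \<zero>\<^bsub>factor_module M N\<^esub>"
    if "X \<in> carrier (factor_module M N)" for X
    using that push[OF _ order_refl] coset_eq_zero_iff Inter_P
    unfolding factor_module_carrier by auto
  then have "family_Inter (factor_module M N) I L = {\<zero>\<^bsub>factor_module M N\<^esub>}"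
    using quotient.M.zero_closed by (auto simp: family_Inter_def)
  moreover have "submodule (L i) R (factor_module M N)" if "i \<in> I" for i
    unfolding L_def using that P submodule_image_in_factor_module by blast
  ultimately obtain J where J: "finite J" "J \<subseteq> I"
    "(\<lambda>X. s \<odot>\<^bsub>factor_module M N\<^esub> X) ` family_Inter (factor_module M N) J L
      = {\<zero>\<^bsub>factor_module M N\<^esub>}"
    using u_S_cofinite_any_index[OF cof I, of L] by meson
  have "s \<odot>\<^bsub>M\<^esub> x \<in> N" if x: "x \<in> family_Inter M J P" for x
  proof -
    have car: "x \<in> carrier M"
      using x by (simp add: family_Inter_def)
    then have "s \<odot>\<^bsub>factor_module M N\<^esub> (N +>\<^bsub>M\<^esub> x) = \<zero>\<^bsub>factor_module M N\<^esub>"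
      using J(2,3) push x by blast
    then show ?thesis
      using smult_factor_module_eq_zero_iff[OF s car] by simp
  qed
  then show ?thesis
    using J(1,2) by blast
qed

end

lemma factor_modules_cofinite_imp_finite_Inter_condition:
  assumes s: "s \<in> carrier R"
    and cof: "\<And>N. submodule N R M \<Longrightarrow> u_S_cofinite R (factor_module M N) s"
  shows "finite_Inter_condition R M s"
  unfolding finite_Inter_condition_def
proof (intro allI impI)
  fix I :: "'c set set" and P
  assume IP: "I \<noteq> {} \<and> (\<forall>i\<in>I. submodule (P i) R M)"
  then have P: "submodule (P i) R M" if "i \<in> I" for i
    using that by blast
  have "submodule (family_Inter M I P) R M"
    by (rule submodule_family_Inter) (rule P)
  then show "\<exists>J. finite J \<and> J \<subseteq> I \<and>
      (\<lambda>x. s \<odot>\<^bsub>M\<^esub> x) ` family_Inter M J P \<subseteq> family_Inter M I P"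
    by (intro finite_Inter_if_factor_module_cofinite[OF _ s cof]) (use IP P in auto)
qed

end

theorem theorem2p15:
  fixes R :: "('a, 'r) ring_scheme" and M :: "('a, 'b, 'm) module_scheme"
    and S :: "'a set" and s :: 'a
  assumes "cring R" and "submonoid S R" and "module R M" and "s \<in> S"
  shows "(u_S_Artinian R M s \<longleftrightarrow> S_MIN R M s) \<and>
         (S_MIN R M s \<longleftrightarrow> finite_Inter_condition R M s) \<and>
         (finite_Inter_condition R M s \<longleftrightarrow>
           (\<forall>N. submodule N R M \<longrightarrow> u_S_cofinite R (factor_module M N) s))"
proof -
  have s: "s \<in> carrier R"
    using submonoid.subset[OF assms(2)] assms(4) by blast
  show ?thesis
    using u_S_Artinian_imp_S_MIN[of R M s]
      S_MIN_imp_finite_Inter_condition[OF assms(3) s]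
      finite_Inter_condition_imp_u_S_Artinian[OF assms(3)]
      module.finite_Inter_condition_imp_factor_module_cofinite[OF assms(3) _ s]
      module.factor_modules_cofinite_imp_finite_Inter_condition[OF assms(3) s]
    by blast
qed

end
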